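(* Let $X$ be a (real or complex) Banach space. If $X$ is sluacs, then $X$ does not contain $\Delta$-points.
   Context: $B_X$, $S_X$ denote the closed unit ball and unit sphere of $X$, and $X^*$ its dual. $X$ is strongly locally uniformly alternatively convex or smooth (sluacs) if for every $x \in S_X$ and all sequences $(x_n) \subset S_X$, $(x_n^* ) \subset S_{X^*}$, the conditions $\|x_n + x\| \to 2$ and $x_n^*(x_n) \to 1$ imply $x_n^*(x) \to 1$. For $x \in S_X$ and $\epsilon>0$ put $\Delta_\epsilon(x) = \{y \in B_X : \|x-y\| \geq 2-\epsilon\}$. A point $x \in S_X$ is a $\Delta$-point if $x \in \overline{\mathrm{conv}}\,\Delta_\epsilon(x)$ (closed convex hull) for every $\epsilon>0$. *)

theory Defs
  imports "HOL-Analysis.Analysis"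
begin

text \<open>The library has no class of complex Banach spaces. A Banach space over a scalar field
  \<open>'k\<close> (used for \<open>real\<close> and \<open>complex\<close>) is a type of class \<open>banach\<close> together with a scalar
  multiplication by \<open>'k\<close> that extends the real one and makes the norm homogeneous over \<open>'k\<close>.\<close>

locale banach_over = vector_space scl
  for scl :: "'k::real_normed_field \<Rightarrow> 'a::banach \<Rightarrow> 'a" +
  assumes scale_of_real: "scl (of_real r) x = r *\<^sub>R x"
    and norm_scale: "norm (scl c x) = norm c * norm x"

lemma banach_over_real: "banach_over ((*\<^sub>R) :: real \<Rightarrow> 'a::banach \<Rightarrow> 'a)"
  by unfold_locales (simp_all add: scaleR_add_right scaleR_add_left)

lemma banach_over_complex: "banach_over ((*) :: complex \<Rightarrow> complex \<Rightarrow> complex)"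
  by unfold_locales (simp_all add: algebra_simps norm_mult scaleR_conv_of_real)

text \<open>The type \<open>'a \<Rightarrow>\<^sub>L 'k\<close> only requires linearity over the reals, so linearity over \<open>'k\<close> is
  imposed separately; the norm is the operator norm.\<close>

definition dual_sphere ::
    "('k::real_normed_field \<Rightarrow> 'a::real_normed_vector \<Rightarrow> 'a) \<Rightarrow> ('a \<Rightarrow>\<^sub>L 'k) set"
  where "dual_sphere scl =
    {f. (\<forall>c x. blinfun_apply f (scl c x) = c * blinfun_apply f x) \<and> norm f = 1}"

definition sluacs :: "('k::real_normed_field \<Rightarrow> 'a::real_normed_vector \<Rightarrow> 'a) \<Rightarrow> bool"
  where "sluacs scl \<longleftrightarrow>
    (\<forall>x \<in> sphere 0 1. \<forall>(xs :: nat \<Rightarrow> 'a) (fs :: nat \<Rightarrow> 'a \<Rightarrow>\<^sub>L 'k).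
      range xs \<subseteq> sphere 0 1 \<longrightarrow> range fs \<subseteq> dual_sphere scl \<longrightarrow>
      (\<lambda>n. norm (xs n + x)) \<longlonglongrightarrow> 2 \<longrightarrow>
      (\<lambda>n. blinfun_apply (fs n) (xs n)) \<longlonglongrightarrow> 1 \<longrightarrow>
      (\<lambda>n. blinfun_apply (fs n) x) \<longlonglongrightarrow> 1)"

definition Delta_set :: "real \<Rightarrow> 'a::real_normed_vector \<Rightarrow> 'a set"
  where "Delta_set \<epsilon> x = {y \<in> cball 0 1. norm (x - y) \<ge> 2 - \<epsilon>}"

definition Delta_point :: "'a::real_normed_vector \<Rightarrow> bool"
  where "Delta_point x \<longleftrightarrow>
    x \<in> sphere 0 1 \<and> (\<forall>\<epsilon>>0. x \<in> closure (convex hull (Delta_set \<epsilon> x)))"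

end

theory Submission imports Defs begin

text \<open>Let \<open>f\<close> be a norming functional of a \<open>\<Delta>\<close>-point \<open>x\<close>. A half-space \<open>{y. Re (f y) \<le> c}\<close> with
  \<open>c < 1\<close> cannot contain \<open>\<Delta>\<^sub>\<epsilon>(x)\<close>, since it would then contain \<open>x\<close>; so there are \<open>y\<^sub>n\<close> in the
  unit ball with \<open>\<parallel>x - y\<^sub>n\<parallel> \<rightarrow> 2\<close> and \<open>f y\<^sub>n \<rightarrow> 1\<close>. Applied to the normalizations of \<open>- y\<^sub>n\<close> and to the
  functional \<open>- f\<close>, sluacs yields \<open>- f x = 1\<close>, contradicting \<open>f x = 1\<close>. The norming functional
  comes from Hahn--Banach: a minimal sublinear functional below the norm is linear.\<close>

section \<open>Sublinear functionals and tilting\<close>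

definition sublinear :: "('a::real_vector \<Rightarrow> real) \<Rightarrow> bool"
  where "sublinear p \<longleftrightarrow>
    (\<forall>x y. p (x + y) \<le> p x + p y) \<and> (\<forall>c\<ge>0. \<forall>x. p (c *\<^sub>R x) = c * p x)"

lemma sublinear_add: "sublinear p \<Longrightarrow> p (x + y) \<le> p x + p y"
  and sublinear_scaleR: "sublinear p \<Longrightarrow> 0 \<le> c \<Longrightarrow> p (c *\<^sub>R x) = c * p x"
  by (auto simp: sublinear_def)

lemma sublinear_zero: "sublinear p \<Longrightarrow> p 0 = 0"
  using sublinear_scaleR[of p 0 0] by simp

lemma sublinear_minus: "sublinear p \<Longrightarrow> - p (- x) \<le> p x"
  using sublinear_add[of p x "- x"] sublinear_zero[of p] by simp

text \<open>Applying the inequality to \<open>inverse c\<close> at the point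
  \<open>c *\<^sub>R x\<close> gives the reverse one; the value at 0 settles
  \<open>c = 0\<close>.\<close>

lemma sublinearI_le:
  assumes "\<And>x y. p (x + y) \<le> p x + p y" and "p 0 = 0"
    and "\<And>c x. 0 < c \<Longrightarrow> p (c *\<^sub>R x) \<le> c * p x"
  shows "sublinear p"
  unfolding sublinear_def
proof (intro conjI allI impI)
  fix c :: real and x :: 'a
  assume "0 \<le> c"
  show "p (c *\<^sub>R x) = c * p x"
  proof (cases "c = 0")
    case False
    with \<open>0 \<le> c\<close> have "0 < c" by simp
    then have "p x \<le> inverse c * p (c *\<^sub>R x)"
      using assms(3)[of "inverse c" "c *\<^sub>R x"] by simp
    with \<open>0 < c\<close> have "c * p x \<le> p (c *\<^sub>R x)"
      by (simp add: field_simps)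
    with assms(3)[OF \<open>0 < c\<close>, of x] show ?thesis by simp
  qed (simp add: assms(2))
qed (rule assms(1))

text \<open>The largest sublinear functional below \<open>p\<close> that is at most \<open>- p z\<close> at \<open>- z\<close>.\<close>

definition tilt :: "('a::real_vector \<Rightarrow> real) \<Rightarrow> 'a \<Rightarrow> 'a \<Rightarrow> real"
  where "tilt p z y = (INF t\<in>{0..}. p (y + t *\<^sub>R z) - t * p z)"

context
  fixes p :: "'a::real_vector \<Rightarrow> real" and z :: 'a
  assumes p: "sublinear p"
begin

text \<open>Since \<open>t * p z = p (t *\<^sub>R z)\<close>, subadditivity yields a bound free of
  \<open>t\<close>, so the infimum defining \<open>tilt\<close> is over a set bounded below.\<close>

lemma tilt_ge: "0 \<le> t \<Longrightarrow> - p (- y) \<le> p (y + t *\<^sub>R z) - t * p z"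
  using sublinear_add[OF p, of "y + t *\<^sub>R z" "- y"] sublinear_scaleR[OF p, of t z] by simp

lemma tilt_le: "0 \<le> t \<Longrightarrow> tilt p z y \<le> p (y + t *\<^sub>R z) - t * p z"
  unfolding tilt_def by (rule cINF_lower) (auto intro!: bdd_belowI2 tilt_ge)

lemma tilt_greatest:
  "(\<And>t. 0 \<le> t \<Longrightarrow> a \<le> p (y + t *\<^sub>R z) - t * p z) \<Longrightarrow> a \<le> tilt p z y"
  unfolding tilt_def by (rule cINF_greatest) auto

lemma tilt_le_self: "tilt p z y \<le> p y"
  using tilt_le[of 0 y] by simp

lemma tilt_minus: "tilt p z (- z) \<le> - p z"
  using tilt_le[of 1 "- z"] sublinear_zero[OF p] by simp

lemma sublinear_tilt: "sublinear (tilt p z)"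
proof (rule sublinearI_le)
  fix x y :: 'a
  \<comment> \<open>Parameters \<open>t\<close> at \<open>x\<close> and \<open>s\<close> at
    \<open>y\<close> combine to \<open>t + s\<close> at \<open>x + y\<close>. The infimum over
    \<open>t\<close> is taken first, with \<open>s\<close> fixed, and the one over \<open>s\<close>
    afterwards.\<close>
  have "tilt p z (x + y) - (p (y + s *\<^sub>R z) - s * p z) \<le> tilt p z x" if "0 \<le> s" for s
  proof (rule tilt_greatest)
    fix t :: real assume "0 \<le> t"
    have "tilt p z (x + y) \<le> p (x + y + (t + s) *\<^sub>R z) - (t + s) * p z"
      using \<open>0 \<le> t\<close> \<open>0 \<le> s\<close> by (intro tilt_le) simp
    also have "x + y + (t + s) *\<^sub>R z = (x + t *\<^sub>R z) + (y + s *\<^sub>R z)"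
      by (simp add: algebra_simps)
    finally show "tilt p z (x + y) - (p (y + s *\<^sub>R z) - s * p z) \<le> p (x + t *\<^sub>R z) - t * p z"
      using sublinear_add[OF p, of "x + t *\<^sub>R z" "y + s *\<^sub>R z"] by (simp add: algebra_simps)
  qed
  then have "tilt p z (x + y) - tilt p z x \<le> tilt p z y"
    by (intro tilt_greatest) (simp add: algebra_simps)
  then show "tilt p z (x + y) \<le> tilt p z x + tilt p z y" by simp
next
  have "0 \<le> tilt p z 0"
    by (rule tilt_greatest) (simp add: sublinear_scaleR[OF p])
  with tilt_le_self[of 0] show "tilt p z 0 = 0"
    using sublinear_zero[OF p] by simp
next
  fix c :: real and x :: 'a assume "0 < c"
  \<comment> \<open>The parameter \<open>c * t\<close> at \<open>c *\<^sub>R x\<close> matches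
    \<open>t\<close> at \<open>x\<close>, so a factor \<open>c\<close> comes out.\<close>
  have "tilt p z (c *\<^sub>R x) / c \<le> tilt p z x"
  proof (rule tilt_greatest)
    fix t :: real assume "0 \<le> t"
    have "tilt p z (c *\<^sub>R x) \<le> p (c *\<^sub>R x + (c * t) *\<^sub>R z) - (c * t) * p z"
      using \<open>0 \<le> t\<close> \<open>0 < c\<close> by (intro tilt_le) simp
    also have "c *\<^sub>R x + (c * t) *\<^sub>R z = c *\<^sub>R (x + t *\<^sub>R z)"
      by (simp add: algebra_simps)
    finally show "tilt p z (c *\<^sub>R x) / c \<le> p (x + t *\<^sub>R z) - t * p z"
      using \<open>0 < c\<close> sublinear_scaleR[OF p, of c "x + t *\<^sub>R z"] by (simp add: field_simps)
  qed
  with \<open>0 < c\<close> show "tilt p z (c *\<^sub>R x) \<le> c * tilt p z x"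
    by (simp add: field_simps)
qed

end

section \<open>The Hahn--Banach theorem by Zorn's lemma\<close>

lemma sublinear_INF_chain:
  fixes C :: "('a::real_vector \<Rightarrow> real) set"
  assumes "C \<noteq> {}" and sub: "\<And>q. q \<in> C \<Longrightarrow> sublinear q"
    and bdd: "\<And>x. bdd_below ((\<lambda>q. q x) ` C)"
    and chain: "\<And>q r. q \<in> C \<Longrightarrow> r \<in> C \<Longrightarrow> q \<le> r \<or> r \<le> q"
  shows "sublinear (\<lambda>x. INF q\<in>C. q x)"
proof (rule sublinearI_le)
  fix x y :: 'a
  let ?m = "\<lambda>x. INF q\<in>C. q x"
  have "?m (x + y) - q x \<le> r y" if "q \<in> C" "r \<in> C" for q r
  proof -
    \<comment> \<open>The smaller of \<open>q\<close> and \<open>r\<close> replaces both, so the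
      subadditivity of a single functional suffices.\<close>
    obtain s where "s \<in> C" "s \<le> q" "s \<le> r"
      using chain[OF \<open>q \<in> C\<close> \<open>r \<in> C\<close>] \<open>q \<in> C\<close> \<open>r \<in> C\<close> by auto
    have "?m (x + y) \<le> s (x + y)"
      using bdd \<open>s \<in> C\<close> by (rule cINF_lower)
    also have "\<dots> \<le> s x + s y"
      using sub[OF \<open>s \<in> C\<close>] by (rule sublinear_add)
    also have "\<dots> \<le> q x + r y"
      using \<open>s \<le> q\<close> \<open>s \<le> r\<close> by (intro add_mono) (auto simp: le_fun_def)
    finally show ?thesis by simp
  qed
  then have "?m (x + y) - q x \<le> ?m y" if "q \<in> C" for q
    using that \<open>C \<noteq> {}\<close> by (intro cINF_greatest)
  then have "?m (x + y) - ?m y \<le> ?m x"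
    using \<open>C \<noteq> {}\<close> by (intro cINF_greatest) (simp_all add: diff_le_eq add.commute)
  then show "?m (x + y) \<le> ?m x + ?m y" by simp
next
  show "(INF q\<in>C. q 0) = 0"
    using \<open>C \<noteq> {}\<close> sub by (simp add: sublinear_zero cong: INF_cong_simp)
next
  fix c :: real and x :: 'a assume "0 < c"
  have "(INF q\<in>C. q (c *\<^sub>R x)) / c \<le> (INF q\<in>C. q x)"
  proof (rule cINF_greatest)
    fix q assume "q \<in> C"
    then have "(INF q\<in>C. q (c *\<^sub>R x)) \<le> q (c *\<^sub>R x)"
      using bdd by (intro cINF_lower)
    with \<open>0 < c\<close> \<open>q \<in> C\<close> show "(INF q\<in>C. q (c *\<^sub>R x)) / c \<le> q x"
      by (simp add: sublinear_scaleR[OF sub] field_simps)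
  qed fact
  with \<open>0 < c\<close> show "(INF q\<in>C. q (c *\<^sub>R x)) \<le> c * (INF q\<in>C. q x)"
    by (simp add: field_simps)
qed

text \<open>Tilting cannot lower a minimal \<open>p\<close>, so \<open>tilt p z = p\<close>;
  evaluation at \<open>- z\<close> makes \<open>p\<close> odd, and an odd sublinear functional is
  linear.\<close>

lemma linear_if_minimal_sublinear:
  assumes "sublinear p" and min: "\<And>q. sublinear q \<Longrightarrow> q \<le> p \<Longrightarrow> q = p"
  shows "linear p"
proof -
  have "tilt p z = p" for z
    using assms(1) by (intro min) (auto simp: le_fun_def sublinear_tilt tilt_le_self)
  then have "p (- z) \<le> - p z" for z
    using tilt_minus[OF assms(1), of z] by simp
  with sublinear_minus[OF assms(1)] have neg: "p (- z) = - p z" for z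
    by (smt (verit))
  show ?thesis
  proof (rule linearI)
    fix x y
    have "p x \<le> p (x + y) + p (- y)"
      using sublinear_add[OF assms(1), of "x + y" "- y"] by simp
    with sublinear_add[OF assms(1), of x y] show "p (x + y) = p x + p y"
      by (simp add: neg)
  next
    fix c x
    show "p (c *\<^sub>R x) = c *\<^sub>R p x"
      using sublinear_scaleR[OF assms(1), of c x] sublinear_scaleR[OF assms(1), of "- c" x]
        neg[of "c *\<^sub>R x"]
      by (cases "0 \<le> c") auto
  qed
qed

theorem Hahn_Banach_sublinear:
  fixes p :: "'a::real_vector \<Rightarrow> real"
  assumes "sublinear p"
  obtains f where "linear f" "f \<le> p"
proof -
  define A where "A = {q. sublinear q \<and> q \<le> p}"
  \<comment> \<open>The order is reversed, so that a maximal element in Zorn's lemma is a minimal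
    functional.\<close>
  let ?R = "relation_of (\<lambda>q r. r \<le> q) A"
  have "\<exists>m\<in>A. \<forall>q\<in>A. q \<le> m \<longrightarrow> q = m"
  proof (rule predicate_Zorn)
    show "partial_order_on A ?R"
      by (rule partial_order_on_relation_ofI) auto
  next
    fix C assume "C \<in> Chains ?R"
    then have C: "q \<in> A" and chain: "q \<le> r \<or> r \<le> q" if "q \<in> C" "r \<in> C" for q r
      using that by (auto simp: Chains_def relation_of_def)
    show "\<exists>u\<in>A. \<forall>q\<in>C. u \<le> q"
    proof (cases "C = {}")
      \<comment> \<open>The infimum over an empty chain is unspecified, so \<open>p\<close> itself
        serves as the bound.\<close>
      case True
      with assms show ?thesis by (auto simp: A_def)
    next
      case False
      \<comment> \<open>From \<open>q \<le> p\<close> at \<open>- x\<close>: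
        \<open>- p (- x) \<le> - q (- x) \<le> q x\<close>.\<close>
      have "- p (- x) \<le> q x" if "q \<in> C" for q x
        using C[OF that that] sublinear_minus[of q x]
        by (auto simp: A_def le_fun_def intro: order_trans[rotated])
      then have bdd: "bdd_below ((\<lambda>q. q x) ` C)" for x
        by (rule bdd_belowI2)
      have lower: "(\<lambda>x. INF q\<in>C. q x) \<le> q" if "q \<in> C" for q
        using that bdd by (auto simp: le_fun_def intro: cINF_lower)
      have "sublinear (\<lambda>x. INF q\<in>C. q x)"
        using False C chain bdd by (intro sublinear_INF_chain) (auto simp: A_def)
      moreover have "(\<lambda>x. INF q\<in>C. q x) \<le> p"
        using False lower C by (fastforce simp: A_def intro: order_trans)
      ultimately show ?thesis
        using lower by (auto simp: A_def intro!: bexI[of _ "\<lambda>x. INF q\<in>C. q x"])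
    qed
  qed
  then obtain m where "m \<in> A" and "\<And>q. q \<in> A \<Longrightarrow> q \<le> m \<Longrightarrow> q = m"
    by blast
  then have "linear m"
    by (intro linear_if_minimal_sublinear) (auto simp: A_def intro: order_trans)
  with \<open>m \<in> A\<close> show thesis
    by (intro that) (auto simp: A_def)
qed

section \<open>Norming functionals over both scalar fields\<close>

lemma norming_linear_functional:
  fixes x :: "'a::real_normed_vector"
  obtains u where "linear u" "\<And>y. u y \<le> norm y" "u x = norm x"
proof -
  have norm: "sublinear (norm :: 'a \<Rightarrow> real)"
    by (simp add: sublinear_def norm_triangle_ineq)
  \<comment> \<open>Domination by \<open>tilt norm x\<close> instead of \<open>norm\<close> adds
    \<open>u (- x) \<le> - norm x\<close>, which forces \<open>u x = norm x\<close>.\<close>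
  obtain u where u: "linear u" "u \<le> tilt norm x"
    using Hahn_Banach_sublinear[OF sublinear_tilt[OF norm]] .
  have le: "u y \<le> norm y" for y
    using u(2) tilt_le_self[OF norm] by (auto simp: le_fun_def intro: order_trans)
  have "u (- x) \<le> - norm x"
    using u(2) tilt_minus[OF norm, of x] by (auto simp: le_fun_def intro: order_trans)
  then have "u x = norm x"
    using le[of x] linear_neg[OF u(1), of x] by simp
  with u(1) le show thesis by (rule that)
qed

lemma norm_eq_1_if_norming:
  fixes f :: "'a::real_normed_vector \<Rightarrow>\<^sub>L 'k::real_normed_field"
  assumes "\<And>y. norm (blinfun_apply f y) \<le> norm y" "norm x = 1" "blinfun_apply f x = 1"
  shows "norm f = 1"
proof (rule antisym)
  show "norm f \<le> 1"
    using assms(1) by (intro norm_blinfun_bound) auto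
  show "1 \<le> norm f"
    using norm_blinfun[of f x] assms(2,3) by simp
qed

lemma norming_functional_real:
  fixes x :: "'a::real_normed_vector"
  assumes "norm x = 1"
  obtains f where "f \<in> dual_sphere ((*\<^sub>R) :: real \<Rightarrow> 'a \<Rightarrow> 'a)" "blinfun_apply f x = 1"
proof -
  obtain u where u: "linear u" "\<And>y. u y \<le> norm y" "u x = norm x"
    using norming_linear_functional[of x] by metis
  have le: "norm (u y) \<le> norm y" for y
    using u(2)[of y] u(2)[of "- y"] linear_neg[OF u(1), of y] by simp
  have "bounded_linear u"
    using u(1) le by (intro bounded_linear_intro[of _ 1]) (auto simp: linear_add linear_scale)
  then obtain f where f: "blinfun_apply f = u"
    by (metis bounded_linear_Blinfun_apply)
  have "norm f = 1"
    using assms le u(3) f by (intro norm_eq_1_if_norming[of _ x]) auto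
  then show thesis
    using f u assms by (intro that[of f]) (auto simp: dual_sphere_def linear_scale)
qed

text \<open>A real norming functional \<open>u\<close> is the real part of a complex-linear
  \<open>g\<close>; rotating the argument carries the norm bound from \<open>u\<close> to
  \<open>g\<close>.\<close>

lemma norming_functional_complex:
  fixes scl :: "complex \<Rightarrow> 'a::banach \<Rightarrow> 'a"
  assumes "banach_over scl" "norm x = 1"
  obtains f where "f \<in> dual_sphere scl" "blinfun_apply f x = 1"
proof -
  interpret banach_over scl by fact
  obtain u where u: "linear u" "\<And>y. u y \<le> norm y" "u x = norm x"
    using norming_linear_functional[of x] by metis
  define g where "g y = Complex (u y) (- u (scl \<i> y))" for y
  have u_scl: "u (scl c y) = Re c * u y + Im c * u (scl \<i> y)" for c y
  proof -
    have "scl c y = scl (of_real (Re c)) y + scl (of_real (Im c)) (scl \<i> y)"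
      by (metis complex_eq scale_left_distrib scale_scale mult.commute)
    then show ?thesis
      by (simp add: scale_of_real linear_add[OF u(1)] linear_scale[OF u(1)] del: scale_scale)
  qed
  have g_add: "g (y + z) = g y + g z" for y z
    by (simp add: g_def linear_add[OF u(1)] scale_right_distrib complex_eq_iff)
  \<comment> \<open>The real part uses \<open>u_scl\<close> at \<open>c\<close>, the imaginary part
    uses it at \<open>\<i> * c\<close>.\<close>
  have g_scl: "g (scl c y) = c * g y" for c y
    using u_scl[of c y] u_scl[of "\<i> * c" y] by (simp add: g_def complex_eq_iff)
  have g_scaleR: "g (r *\<^sub>R y) = r *\<^sub>R g y" for r y
    using g_scl[of "of_real r" y] by (simp add: scale_of_real scaleR_conv_of_real)
  have le: "norm (g y) \<le> norm y" for y
  proof (cases "g y = 0")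
    case False
    \<comment> \<open>The unimodular \<open>c\<close> rotates \<open>g y\<close> onto the
      nonnegative real axis, where \<open>g\<close> and \<open>u\<close> agree.\<close>
    define c where "c = cnj (g y) / norm (g y)"
    have c: "norm c = 1" "c * g y = norm (g y)"
      using False by (auto simp: c_def norm_divide field_simps power2_eq_square
          complex_norm_square[symmetric] mult.commute[of "cnj _"])
    have "norm (g y) = Re (g (scl c y))"
      by (simp add: g_scl c(2))
    also have "\<dots> = u (scl c y)"
      by (simp add: g_def)
    also have "\<dots> \<le> norm y"
      using u(2)[of "scl c y"] by (simp add: norm_scale c(1))
    finally show ?thesis .
  qed simp
  have "bounded_linear g"
    using le by (intro bounded_linear_intro[of _ 1]) (auto simp: g_add g_scaleR)
  then obtain f where f: "blinfun_apply f = g"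
    by (metis bounded_linear_Blinfun_apply)
  have "Re (g x) = 1"
    using u(3) assms(2) by (simp add: g_def)
  \<comment> \<open>With real part 1 and modulus at most 1, the imaginary part must vanish.\<close>
  moreover have "(Re (g x))\<^sup>2 + (Im (g x))\<^sup>2 \<le> 1"
    using power_mono[OF le[of x], of 2] assms(2) by (simp add: cmod_power2)
  ultimately have "g x = 1"
    by (simp add: complex_eq_iff)
  moreover have "norm f = 1"
    using assms(2) le \<open>g x = 1\<close> f by (intro norm_eq_1_if_norming[of _ x]) auto
  ultimately show thesis
    using f g_scl by (intro that[of f]) (auto simp: dual_sphere_def)
qed

section \<open>Delta-points against sluacs\<close>

lemma Delta_point_in_half_space:
  assumes "Delta_point x" "bounded_linear u" "0 < \<epsilon>" "c < u x"
  obtains y where "y \<in> Delta_set \<epsilon> x" "(c::real) < u y"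
proof (rule ccontr)
  interpret u: bounded_linear u by fact
  assume "\<not> thesis"
  then have "Delta_set \<epsilon> x \<subseteq> u -` {..c}"
    using that by force
  moreover have "convex (u -` {..c})"
    by (intro convex_linear_vimage u.linear_axioms) simp
  ultimately have "convex hull Delta_set \<epsilon> x \<subseteq> u -` {..c}"
    by (rule hull_minimal)
  moreover have "closed (u -` {..c})"
    by (intro closed_vimage u.continuous_on continuous_on_id) auto
  ultimately have "closure (convex hull Delta_set \<epsilon> x) \<subseteq> u -` {..c}"
    by (rule closure_minimal)
  with assms(1,3,4) show False
    by (auto simp: Delta_point_def)
qed

text \<open>The class \<open>real_inner\<close> covers both scalar fields: \<open>c \<bullet> 1\<close> is the real part of \<open>c\<close>.\<close>

lemma no_Delta_point_if_norming:
  fixes scl :: "'k::{real_normed_field, real_inner} \<Rightarrow> 'a::real_normed_vector \<Rightarrow> 'a"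
  assumes sluacs: "sluacs scl" and f: "f \<in> dual_sphere scl" "blinfun_apply f x = 1"
  shows "\<not> Delta_point x"
proof
  assume x: "Delta_point x"
  \<comment> \<open>Halving keeps \<open>\<epsilon> n < 1\<close> also for \<open>n = 0\<close>, so
    every \<open>y n\<close> is nonzero and can be normalized.\<close>
  define \<epsilon> :: "nat \<Rightarrow> real" where "\<epsilon> n = inverse (real (Suc n)) / 2" for n
  have \<epsilon>: "0 < \<epsilon> n" "\<epsilon> n < 1" for n
    by (auto simp: \<epsilon>_def field_simps)
  have lim_\<epsilon>: "\<epsilon> \<longlonglongrightarrow> 0"
    unfolding \<epsilon>_def using tendsto_divide[OF LIMSEQ_inverse_real_of_nat tendsto_const, of 2] by simp
  have norm_x: "norm x = 1"
    using x by (simp add: Delta_point_def)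
  have "\<exists>y. y \<in> Delta_set (\<epsilon> n) x \<and> 1 - \<epsilon> n < blinfun_apply f y \<bullet> 1" for n
    using Delta_point_in_half_space[OF x, of "\<lambda>y. blinfun_apply f y \<bullet> 1" "\<epsilon> n" "1 - \<epsilon> n"] \<epsilon>[of n]
    by (auto simp: f(2) dot_square_norm intro: bounded_linear_inner_left_comp blinfun.bounded_linear_right)
  then obtain y where y: "y n \<in> Delta_set (\<epsilon> n) x" "1 - \<epsilon> n < blinfun_apply f (y n) \<bullet> 1" for n
    by metis
  \<comment> \<open>The last bound comes from
    \<open>2 - \<epsilon> n \<le> norm (x - y n) \<le> 1 + norm (y n)\<close>.\<close>
  have norm_y: "norm (y n) \<le> 1" "2 - \<epsilon> n \<le> norm (x - y n)" "1 - \<epsilon> n \<le> norm (y n)" for n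
    using y(1)[of n] norm_triangle_ineq4[of x "y n"] norm_x by (auto simp: Delta_set_def)
  have lim_norm: "(\<lambda>n. norm (y n)) \<longlonglongrightarrow> 1"
    by (rule tendsto_sandwich[of "\<lambda>n. 1 - \<epsilon> n" _ _ "\<lambda>n. 1"])
      (use norm_y lim_\<epsilon> in \<open>auto intro!: tendsto_eq_intros\<close>)
  have nonzero: "y n \<noteq> 0" for n
    using norm_y(3)[of n] \<epsilon>[of n] by auto
  have lim_f: "(\<lambda>n. blinfun_apply f (y n)) \<longlonglongrightarrow> 1"
  proof -
    \<comment> \<open>The square expands to the squared norm of the value, minus twice its real
      part, plus 1, hence is at most \<open>2 - 2 * (1 - \<epsilon> n)\<close>. A real part near 1
      thus controls the whole scalar.\<close>
    have "(norm (blinfun_apply f (y n) - 1))\<^sup>2 \<le> 2 * \<epsilon> n" for n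
    proof -
      have "norm (blinfun_apply f (y n)) \<le> 1"
        using norm_blinfun[of f "y n"] f(1) norm_y(1)[of n] by (simp add: dual_sphere_def)
      then have "blinfun_apply f (y n) \<bullet> blinfun_apply f (y n) \<le> 1"
        by (simp add: dot_square_norm abs_square_le_1)
      moreover have "(1::'k) \<bullet> 1 = 1"
        by (simp add: dot_square_norm)
      ultimately show ?thesis
        using y(2)[of n]
        by (simp add: power2_norm_eq_inner inner_diff_left inner_diff_right inner_commute)
    qed
    then have "(\<lambda>n. (norm (blinfun_apply f (y n) - 1))\<^sup>2) \<longlonglongrightarrow> 0"
      by (intro Lim_null_comparison[OF _ tendsto_mult_right_zero[OF lim_\<epsilon>, of 2]]) simp
    then have "(\<lambda>n. norm (blinfun_apply f (y n) - 1)) \<longlonglongrightarrow> 0"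
      by simp
    then show ?thesis
      using LIM_zero_cancel tendsto_norm_zero_iff by blast
  qed
  \<comment> \<open>The sign makes \<open>xs n + x\<close> close to \<open>x - y n\<close>, whose
    norm tends to 2.\<close>
  define xs where "xs n = - (inverse (norm (y n)) *\<^sub>R y n)" for n
  have "(\<lambda>n. norm (xs n + x)) \<longlonglongrightarrow> 2"
  proof (rule tendsto_sandwich[of "\<lambda>n. 2 - \<epsilon> n - (1 - norm (y n))" _ _ "\<lambda>n. 2"])
    \<comment> \<open>Normalization moves \<open>y n\<close> by exactly
      \<open>1 - norm (y n)\<close>, which tends to 0.\<close>
    have "norm (x - y n) \<le> norm (xs n + x) + (1 - norm (y n))" for n
    proof -
      have "norm (- xs n - y n) = norm ((inverse (norm (y n)) - 1) *\<^sub>R y n)"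
        by (simp add: xs_def algebra_simps)
      also have "\<dots> = 1 - norm (y n)"
        using nonzero[of n] norm_y(1)[of n] by (simp add: one_le_inverse_iff field_simps)
      finally show ?thesis
        using norm_triangle_ineq[of "xs n + x" "- xs n - y n"] by simp
    qed
    with norm_y(2) show "\<forall>\<^sub>F n in sequentially. 2 - \<epsilon> n - (1 - norm (y n)) \<le> norm (xs n + x)"
      by (intro always_eventually allI) (smt (verit))
    have "norm (xs n + x) \<le> 2" for n
      using norm_triangle_ineq[of "xs n" x] nonzero[of n] norm_x by (simp add: xs_def)
    then show "\<forall>\<^sub>F n in sequentially. norm (xs n + x) \<le> 2" by simp
    show "(\<lambda>n. 2 - \<epsilon> n - (1 - norm (y n))) \<longlonglongrightarrow> 2"
      using tendsto_diff[OF tendsto_diff[OF tendsto_const lim_\<epsilon>]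
          tendsto_diff[OF tendsto_const lim_norm], of 2 1] by simp
  qed simp
  moreover have "(\<lambda>n. blinfun_apply (- f) (xs n)) \<longlonglongrightarrow> 1"
    using tendsto_scaleR[OF tendsto_inverse[OF lim_norm] lim_f]
    by (simp add: xs_def blinfun.minus_left blinfun.minus_right blinfun.scaleR_right)
  moreover have "range xs \<subseteq> sphere 0 1"
    using nonzero by (auto simp: xs_def)
  moreover have "- f \<in> dual_sphere scl"
    using f(1) by (auto simp: dual_sphere_def blinfun.minus_left)
  then have "range (\<lambda>n::nat. - f) \<subseteq> dual_sphere scl"
    by auto
  ultimately have "(\<lambda>n::nat. blinfun_apply (- f) x) \<longlonglongrightarrow> 1"
    using sluacs norm_x unfolding sluacs_def by (auto dest!: bspec[of _ _ x])
  then have "(- 1 :: 'k) = 1"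
    by (simp add: f(2) blinfun.minus_left LIMSEQ_const_iff)
  then show False by simp
qed

theorem corollary3p9:
  fixes scaleC :: "complex \<Rightarrow> 'b::banach \<Rightarrow> 'b"
  shows "(sluacs ((*\<^sub>R) :: real \<Rightarrow> 'a::banach \<Rightarrow> 'a) \<longrightarrow> \<not> (\<exists>x::'a. Delta_point x))
    \<and> (banach_over scaleC \<and> sluacs scaleC \<longrightarrow> \<not> (\<exists>x::'b. Delta_point x))"
proof (intro conjI impI notI; elim exE conjE)
  fix x :: 'a
  assume "sluacs ((*\<^sub>R) :: real \<Rightarrow> 'a \<Rightarrow> 'a)" and x: "Delta_point x"
  moreover obtain f where "f \<in> dual_sphere ((*\<^sub>R) :: real \<Rightarrow> 'a \<Rightarrow> 'a)" "blinfun_apply f x = 1"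
    using x norming_functional_real[of x] by (auto simp: Delta_point_def)
  ultimately show False
    using no_Delta_point_if_norming by blast
next
  fix x :: 'b
  assume "banach_over scaleC" "sluacs scaleC" and x: "Delta_point x"
  moreover from this obtain f where "f \<in> dual_sphere scaleC" "blinfun_apply f x = 1"
    using norming_functional_complex[of scaleC x] by (auto simp: Delta_point_def)
  ultimately show False
    using no_Delta_point_if_norming by blast
qed

end
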